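(* Let $p$ be a positive integer, and let $$L=\frac{1+\sqrt{4p^2+1}}{2p},\qquad l=\frac1L.$$ Then, for every $n\ge1$, $$\pi_{1,p}(n)\in\{\lfloor nL\rfloor+\epsilon,\ \lfloor nl\rfloor+\epsilon : \epsilon\in\{-1,0,1,2\}\}.$$
   Context: $\mathbb{N}$ denotes the positive integers. The permutation $\pi_{1,p}:\mathbb{N}\to\mathbb{N}$ is the greedy permutation associated with the multiset of differences consisting of $p$ copies of each integer; it is the involution such that the pairs $(n-1,\pi_{1,p}(n)-1)$, $n\ge1$, are the $P$-positions of $(p,1)$-Wythoff Nim. Explicitly: for $i=0,1,2,\dots$ let $a_i$ be the least non-negative integer not in $\{a_j,b_j:0\le j<i\}$ and $b_i=a_i+\lfloor i/p\rfloor$; then $\pi_{1,p}(a_i+1)=b_i+1$ and $\pi_{1,p}(b_i+1)=a_i+1$ for all $i\ge0$. (In particular $\pi_{1,p}(n)=n$ for $1\le n\le p$.) *)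

theory Defs
  imports Complex_Main
begin

text \<open>The pairs \<open>(wyt_a p i, wyt_b p i)\<close>, over the non-negative integers, are
  the P-positions (smaller entry first) of \<open>(p,1)\<close>-Wythoff Nim.\<close>

fun wyt_a :: "nat \<Rightarrow> nat \<Rightarrow> nat" where
  "wyt_a p i =
     (LEAST m. m \<notin> (\<lambda>j. wyt_a p j) ` {..<i} \<union> (\<lambda>j. wyt_a p j + j div p) ` {..<i})"

declare wyt_a.simps [simp del]

definition wyt_b :: "nat \<Rightarrow> nat \<Rightarrow> nat" where
  "wyt_b p i = wyt_a p i + i div p"

text \<open>The positive integers are the elements \<open>n \<ge> 1\<close> of type \<^typ>\<open>nat\<close>; nothing
  is specified at \<open>n = 0\<close>. That the definite description denotes for \<open>n \<ge> 1\<close> is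
  proved below (\<open>greedy_perm_a\<close>, \<open>greedy_perm_b\<close>, \<open>wyt_cover\<close>).\<close>

definition greedy_perm :: "nat \<Rightarrow> nat \<Rightarrow> nat" where
  "greedy_perm p n =
     (THE m. \<exists>i. (n = wyt_a p i + 1 \<and> m = wyt_b p i + 1) \<or>
                 (n = wyt_b p i + 1 \<and> m = wyt_a p i + 1))"

lemma wyt_a_Least: "wyt_a p i = (LEAST m. m \<notin> wyt_a p ` {..<i} \<union> wyt_b p ` {..<i})"
  by (subst wyt_a.simps) (simp add: wyt_b_def)

lemma wyt_a_notin: "wyt_a p i \<notin> wyt_a p ` {..<i} \<union> wyt_b p ` {..<i}"
proof -
  have "finite (wyt_a p ` {..<i} \<union> wyt_b p ` {..<i})" by simp
  then obtain m where "m \<notin> wyt_a p ` {..<i} \<union> wyt_b p ` {..<i}"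
    using ex_new_if_finite[OF infinite_UNIV_nat] by blast
  then show ?thesis by (subst wyt_a_Least) (rule LeastI)
qed

lemma wyt_a_le: "m \<notin> wyt_a p ` {..<i} \<union> wyt_b p ` {..<i} \<Longrightarrow> wyt_a p i \<le> m"
  by (subst wyt_a_Least) (rule Least_le)

lemma strict_mono_wyt_a: "strict_mono (wyt_a p)"
proof (rule strict_mono_Suc_iff[THEN iffD2], rule allI)
  fix i
  have "wyt_a p (Suc i) \<notin> wyt_a p ` {..<i} \<union> wyt_b p ` {..<i}"
    using wyt_a_notin[of p "Suc i"] by (auto simp: lessThan_Suc)
  then have "wyt_a p i \<le> wyt_a p (Suc i)" by (rule wyt_a_le)
  moreover have "wyt_a p (Suc i) \<noteq> wyt_a p i"
    using wyt_a_notin[of p "Suc i"] by auto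
  ultimately show "wyt_a p i < wyt_a p (Suc i)" by simp
qed

lemma strict_mono_wyt_b: "strict_mono (wyt_b p)"
proof (rule strict_monoI)
  fix i j :: nat assume "i < j"
  then have "wyt_a p i < wyt_a p j" "i div p \<le> j div p"
    using strict_mono_wyt_a by (auto simp: strict_mono_def div_le_mono)
  then show "wyt_b p i < wyt_b p j" by (simp add: wyt_b_def)
qed

lemma wyt_a_eq_wyt_b: "wyt_a p i = wyt_b p j \<Longrightarrow> i = j"
proof (cases i j rule: linorder_cases)
  case less
  assume "wyt_a p i = wyt_b p j"
  moreover have "wyt_a p i < wyt_a p j"
    using less strict_mono_wyt_a by (auto simp: strict_mono_def)
  ultimately show ?thesis by (simp add: wyt_b_def)
next
  case greater
  assume "wyt_a p i = wyt_b p j"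
  then show ?thesis using greater wyt_a_notin[of p i] by auto
qed auto

lemma greedy_perm_a: "greedy_perm p (wyt_a p i + 1) = wyt_b p i + 1"
  unfolding greedy_perm_def
  by (rule the_equality)
    (auto dest: wyt_a_eq_wyt_b simp: strict_mono_eq[OF strict_mono_wyt_a])

lemma greedy_perm_b: "greedy_perm p (wyt_b p i + 1) = wyt_a p i + 1"
  unfolding greedy_perm_def
  by (rule the_equality)
    (auto dest: wyt_a_eq_wyt_b wyt_a_eq_wyt_b[OF sym]
      simp: strict_mono_eq[OF strict_mono_wyt_b])

lemma wyt_cover:
  assumes "n \<ge> 1"
  shows "\<exists>i. n = wyt_a p i + 1 \<or> n = wyt_b p i + 1"
proof -
  obtain m where n: "n = m + 1" using assms by (metis add.commute le_Suc_ex)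
  have "m \<le> wyt_a p m" using strict_mono_wyt_a by (rule strict_mono_imp_increasing)
  then have "m < wyt_a p (Suc m)"
    using strict_mono_wyt_a[of p] by (meson le_less_trans lessI strict_monoD)
  then have "m \<in> wyt_a p ` {..<Suc m} \<union> wyt_b p ` {..<Suc m}"
    using wyt_a_le[of m p "Suc m"] by force
  then show ?thesis using n by auto
qed

end

theory Submission
  imports Defs
begin

text \<open>
  Put \<open>\<alpha> = 1 + l\<close> and \<open>\<beta> = 1 + L\<close>. Since \<open>L = l + 1/p\<close> and \<open>L l = 1\<close>, these satisfy
  \<open>1/\<alpha> + 1/\<beta> = 1\<close> and \<open>\<beta> = \<alpha> + 1/p = L \<alpha>\<close>, so the \<open>a\<^sub>i\<close> and \<open>b\<^sub>i\<close> should lie at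
  bounded distance from the Beatty sequences \<open>i \<alpha>\<close> and \<open>i \<beta>\<close>, which makes
  \<open>b\<^sub>i + 1\<close> close to \<open>L (a\<^sub>i + 1)\<close>.

  The quantity to control is the deviation \<open>\<delta>\<^sub>i = a\<^sub>i + 1 - i \<alpha>\<close>. For \<open>i \<ge> p\<close>, the
  non-negative integers below \<open>a\<^sub>i\<close>
  are exactly the earlier \<open>a\<^sub>j\<close> and the smaller \<open>b\<^sub>j\<close>; if \<open>k\<close> of the \<open>b\<^sub>j\<close> are smaller,
  counting gives \<open>a\<^sub>i = i + k - p\<close> (\<open>wyt_a_count\<close>), the \<open>p\<close> being subtracted because
  \<open>a\<^sub>j = b\<^sub>j\<close> for \<open>j < p\<close>. As \<open>b\<^bsub>k-1\<^esub> < a\<^sub>i \<le> b\<^sub>k\<close> and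
  \<open>b\<^sub>j + 1 = j \<beta> + \<delta>\<^sub>j - frac (j/p)\<close>, this bounds \<open>\<delta>\<^sub>i\<close> from above by a constant minus
  \<open>l \<delta>\<^bsub>k-1\<^esub>\<close> and from below by a constant minus \<open>l \<delta>\<^sub>k\<close>. Because \<open>l < 1\<close>, there is an
  interval that these bounds map into itself, namely \<open>[-(2p-1) \<alpha>, p \<beta>]\<close>, and induction
  keeps every \<open>\<delta>\<^sub>i\<close> in it (\<open>wyt_a_deviation\<close>). Finally
  \<open>(b\<^sub>i + 1) - L (a\<^sub>i + 1) = -((L - 1) \<delta>\<^sub>i + frac (i/p))\<close>, and multiplying the endpoints
  by \<open>L - 1 = 1/(p \<alpha>)\<close> turns the interval into \<open>[-2 + 1/p, L]\<close>; adding the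
  fractional part, at most \<open>1 - 1/p\<close>, leaves the sum above \<open>-2\<close> and at most \<open>1 + l < 2\<close>.
  So \<open>b\<^sub>i + 1\<close> differs from \<open>L (a\<^sub>i + 1)\<close> by less than \<open>2\<close>, and hence \<open>a\<^sub>i + 1\<close> from
  \<open>l (b\<^sub>i + 1)\<close> by less than \<open>2 l\<close>; an error below \<open>2\<close> is what the four values of
  \<open>\<epsilon>\<close> allow.
\<close>

lemma wyt_a_initial:
  assumes "i < p"
  shows "wyt_a p i = i"
  using assms
proof (induction i rule: less_induct)
  case (less i)
  have "i \<notin> wyt_a p ` {..<i} \<union> wyt_b p ` {..<i}"
    using less by (auto simp: wyt_b_def)
  then have "wyt_a p i \<le> i"
    by (rule wyt_a_le)
  moreover have "i \<le> wyt_a p i"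
    using strict_mono_wyt_a by (rule strict_mono_imp_increasing)
  ultimately show ?case
    by simp
qed

text \<open>The two sequences share precisely the values below \<open>p\<close>, so these must be counted once.\<close>

lemma wyt_a_count:
  assumes p: "p \<ge> 1" and i: "p \<le> i"
  obtains k where "p \<le> k" "k \<le> i" "wyt_a p i + p = i + k"
    "wyt_b p (k - 1) < wyt_a p i" "wyt_a p i \<le> wyt_b p k"
proof -
  define k where "k = (LEAST j. wyt_a p i \<le> wyt_b p j)"
  have ex: "wyt_a p i \<le> wyt_b p i"
    by (simp add: wyt_b_def)
  have k_le: "k \<le> i"
    unfolding k_def using ex by (rule Least_le)
  have upper: "wyt_a p i \<le> wyt_b p k"
    unfolding k_def using ex by (rule LeastI)
  have below: "wyt_b p j < wyt_a p i" if "j < k" for j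
    using not_less_Least[of j "\<lambda>j. wyt_a p i \<le> wyt_b p j"] that by (simp add: k_def)
  have above: "j < k" if "wyt_b p j < wyt_a p i" for j
    using that upper strict_mono_less[OF strict_mono_wyt_b, of p j k] by simp
  have "i \<le> wyt_a p i"
    using strict_mono_wyt_a by (rule strict_mono_imp_increasing)
  then have "wyt_b p (p - 1) < wyt_a p i"
    using p i wyt_a_initial[of "p - 1" p] by (simp add: wyt_b_def)
  then have p_le: "p \<le> k"
    using above[of "p - 1"] by simp
  have "{..<wyt_a p i} = wyt_a p ` {..<i} \<union> wyt_b p ` {p..<k}"
  proof (intro set_eqI iffI)
    fix x assume x: "x \<in> {..<wyt_a p i}"
    then have "x \<in> wyt_a p ` {..<i} \<union> wyt_b p ` {..<i}"
      using wyt_a_le[of x p i] by fastforce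
    then show "x \<in> wyt_a p ` {..<i} \<union> wyt_b p ` {p..<k}"
    proof
      assume "x \<in> wyt_b p ` {..<i}"
      then obtain j where j: "j < i" "x = wyt_b p j"
        by auto
      show ?thesis
      proof (cases "j < p")
        case True
        then have "x = wyt_a p j"
          using j by (simp add: wyt_b_def)
        then show ?thesis
          using j by blast
      next
        case False
        then show ?thesis
          using j x above[of j] by auto
      qed
    qed blast
  next
    fix x assume "x \<in> wyt_a p ` {..<i} \<union> wyt_b p ` {p..<k}"
    then show "x \<in> {..<wyt_a p i}"
      using below strict_mono_less[OF strict_mono_wyt_a, of p] by auto
  qed
  moreover have "wyt_a p ` {..<i} \<inter> wyt_b p ` {p..<k} = {}"
  proof -
    have "wyt_a p j \<noteq> wyt_b p m" if "p \<le> m" for j m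
    proof
      assume eq: "wyt_a p j = wyt_b p m"
      then have "j = m"
        by (rule wyt_a_eq_wyt_b)
      then have "m div p = 0"
        using eq by (simp add: wyt_b_def)
      then show False
        using that p by (simp add: div_eq_0_iff)
    qed
    then show ?thesis
      by auto
  qed
  ultimately have "card {..<wyt_a p i} = card (wyt_a p ` {..<i}) + card (wyt_b p ` {p..<k})"
    by (simp add: card_Un_disjoint)
  then have "wyt_a p i = i + (k - p)"
    using strict_mono_imp_inj_on[OF strict_mono_wyt_a] strict_mono_imp_inj_on[OF strict_mono_wyt_b]
    by (simp add: card_image)
  then show ?thesis
    using that[of k] p_le k_le upper below[of "k - 1"] p by simp
qed

lemma real_div_bounds:
  fixes i p :: nat
  assumes "p \<ge> 1"
  shows "real (i div p) \<le> real i / real p"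
    and "real i / real p - 1 + 1 / real p \<le> real (i div p)"
proof -
  have "i mod p + 1 \<le> p"
    using assms by (simp add: Suc_leI)
  then have "real i + 1 \<le> real p * real (i div p) + real p"
    using mult_div_mod_eq[of p i] by (metis add.assoc add_left_mono of_nat_1 of_nat_add
        of_nat_le_iff of_nat_mult)
  then show "real i / real p - 1 + 1 / real p \<le> real (i div p)"
    using assms by (simp add: field_simps)
qed (metis of_nat_div_le_of_nat)

text \<open>
  The ends \<open>A\<close> and \<open>B = p (1 + L)\<close> are matched to the recursion: a deviation of at most \<open>B\<close> at
  \<open>k\<close> forces one of at least \<open>(1 - p) (1 + l) - l B = A\<close> at \<open>i\<close>, and a deviation of at least
  \<open>A\<close> at \<open>k - 1\<close> forces one of at most \<open>B\<close> at \<open>i\<close>. Multiplying the sandwich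
  \<open>b\<^bsub>k-1\<^esub> < a\<^sub>i \<le> b\<^sub>k\<close> by \<open>l\<close> isolates \<open>k\<close>, since \<open>L = l + 1/p\<close> has inverse \<open>l\<close>.
\<close>

lemma wyt_a_deviation:
  fixes l :: real
  assumes p: "p \<ge> 1" and l: "0 < l" "l < 1" and quad: "l * (l + 1 / real p) = 1"
  shows "- ((2 * real p - 1) * (1 + l)) \<le> real (wyt_a p i) + 1 - real i * (1 + l) \<and>
    real (wyt_a p i) + 1 - real i * (1 + l) \<le> real p * (1 + l) + 1"
proof (induction i rule: less_induct)
  case (less i)
  have p1: "real p \<ge> 1"
    using p by simp
  have sq: "real p * l * l = real p - l"
    using quad p1 by (simp add: field_simps)
  have pl: "0 < real p * l"
    using p1 l by simp
  show ?case
  proof (cases "i < p")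
    case True
    then have "real i * l \<le> real p * l" "0 \<le> real i * l"
      using l by simp_all
    moreover have "real p * l \<le> real p"
      using l p1 by simp
    ultimately show ?thesis
      using p1 l pl unfolding wyt_a_initial[OF True] by (simp only: algebra_simps) linarith
  next
    case False
    then obtain k where k: "p \<le> k" "k \<le> i" "wyt_a p i + p = i + k"
      "wyt_b p (k - 1) < wyt_a p i" "wyt_a p i \<le> wyt_b p k"
      using wyt_a_count[OF p, of i] by auto
    have eq: "real (wyt_a p i) = real i + real k - real p"
      using k(3) by linarith
    have k1: "real (k - 1) = real k - 1"
      using k(1) p by simp
    have "k - 1 < i"
      using k(1,2) p by linarith
    have scale: "real k * (l + 1 / real p) * l = real k"
      using arg_cong[OF quad, of "\<lambda>x. real k * x"] by (simp only: ac_simps mult_1_right)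
    have "real (wyt_b p (k - 1)) + 1 \<le> real (wyt_a p i)"
      using k(4) by linarith
    moreover have "real (wyt_b p (k - 1)) + 1
        \<ge> (real k - 1) * (1 + l) - (2 * real p - 1) * (1 + l) + real k / real p - 1"
      using less.IH[OF \<open>k - 1 < i\<close>] real_div_bounds(2)[OF p, of "k - 1"]
      unfolding k1 wyt_b_def of_nat_add diff_divide_distrib by linarith
    ultimately have "real k * (l + 1 / real p) \<le> real i + real p + 1 + 2 * real p * l"
      using eq by (simp add: algebra_simps)
    then have "real k * (l + 1 / real p) * l \<le> (real i + real p + 1 + 2 * real p * l) * l"
      using l by (intro mult_right_mono) auto
    then have "real k \<le> real i * l + real p * l - l + 2 * real p"
      using scale sq by (simp add: algebra_simps)
    then have up: "real (wyt_a p i) + 1 - real i * (1 + l) \<le> real p * (1 + l) + 1"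
      using eq l by (simp add: algebra_simps)
    have "- ((2 * real p - 1) * (1 + l)) \<le> real (wyt_a p i) + 1 - real i * (1 + l)"
    proof (cases "k = i")
      \<comment> \<open>Here the induction hypothesis is not available at \<open>k\<close>, but \<open>a\<^sub>i = 2i - p\<close> is
        explicit.\<close>
      case True
      have "real i * l \<le> real i"
        using l by (simp add: mult_left_le)
      moreover have "0 \<le> (real p - 1) * l"
        using p1 l by simp
      ultimately show ?thesis
        using eq p1 l pl unfolding True by (simp only: algebra_simps)
    next
      case False
      then have "real (wyt_a p k) + 1 - real k * (1 + l) \<le> real p * (1 + l) + 1"
        using less.IH[of k] k(2) by simp
      then have "real (wyt_b p k) \<le> real k * (1 + l) + real p * (1 + l) + real k / real p"
        using real_div_bounds(1)[OF p, of k] by (simp add: wyt_b_def)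
      then have "real i - 2 * real p - real p * l \<le> real k * (l + 1 / real p)"
        using eq k(5) by (simp add: algebra_simps)
      then have "(real i - 2 * real p - real p * l) * l \<le> real k * (l + 1 / real p) * l"
        using l by (intro mult_right_mono) auto
      then have "real i * l - 2 * real p * l - real p + l \<le> real k"
        using scale sq by (simp add: algebra_simps)
      then show ?thesis
        using eq by (simp add: algebra_simps)
    qed
    with up show ?thesis
      by simp
  qed
qed

lemma wyt_b_near_multiple:
  fixes L l :: real
  assumes p: "p \<ge> 1" and l: "0 < l" "l < 1" and L: "L = l + 1 / real p" and inv: "L * l = 1"
  shows "real (wyt_b p i + 1) - 2 < real (wyt_a p i + 1) * L"
    and "real (wyt_a p i + 1) * L < real (wyt_b p i + 1) + 2"
proof -
  have p1: "real p \<ge> 1"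
    using p by simp
  have "L = 1 / l"
    using inv l by (simp add: eq_divide_eq)
  then have "L > 1"
    using l by simp
  have "(1 + l) * (L - 1) = L * l + (L - l) - 1"
    by (simp add: algebra_simps)
  then have shrink: "(1 + l) * (L - 1) = 1 / real p"
    unfolding inv using L by simp
  have dev: "real i * (1 + l) - (2 * real p - 1) * (1 + l) \<le> real (wyt_a p i + 1)"
      "real (wyt_a p i + 1) \<le> real i * (1 + l) + real p * (1 + l) + 1"
    using wyt_a_deviation[OF p l, of i] inv L by (auto simp: mult.commute)
  have "(real i * (1 + l) - (2 * real p - 1) * (1 + l)) * (L - 1)
      \<le> real (wyt_a p i + 1) * (L - 1)"
    using dev(1) \<open>L > 1\<close> by (intro mult_right_mono) auto
  also have "(real i * (1 + l) - (2 * real p - 1) * (1 + l)) * (L - 1)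
      = (real i - (2 * real p - 1)) * ((1 + l) * (L - 1))"
    by (simp add: algebra_simps)
  also have "\<dots> = real i / real p - 2 + 1 / real p"
    unfolding shrink using p1 by (simp add: field_simps)
  finally have "real i / real p - 2 + 1 / real p \<le> real (wyt_a p i + 1) * (L - 1)" .
  moreover have "0 < 1 / real p"
    using p1 by simp
  ultimately have "real (i div p) - 2 < real (wyt_a p i + 1) * (L - 1)"
    using real_div_bounds(1)[OF p, of i] by linarith
  then show "real (wyt_b p i + 1) - 2 < real (wyt_a p i + 1) * L"
    by (simp add: wyt_b_def algebra_simps)
  have "real (wyt_a p i + 1) * (L - 1)
      \<le> (real i * (1 + l) + real p * (1 + l) + 1) * (L - 1)"
    using dev(2) \<open>L > 1\<close> by (intro mult_right_mono) auto
  also have "\<dots> = (real i + real p) * ((1 + l) * (L - 1)) + (L - 1)"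
    by (simp add: algebra_simps)
  also have "\<dots> = real i / real p + L"
    unfolding shrink using p1 by (simp add: field_simps)
  finally have "real (wyt_a p i + 1) * (L - 1) < real (i div p) + 2"
    using real_div_bounds(2)[OF p, of i] l L by linarith
  then show "real (wyt_a p i + 1) * L < real (wyt_b p i + 1) + 2"
    by (simp add: wyt_b_def algebra_simps)
qed

lemma mem_floor_window:
  fixes x :: real and m :: nat
  assumes "real m - 2 < x" "x < real m + 2"
  shows "int m \<in> {\<lfloor>x\<rfloor> + \<epsilon> | \<epsilon>. \<epsilon> \<in> {-1, 0, 1, 2}}"
proof -
  have "int m - \<lfloor>x\<rfloor> \<in> {-1, 0, 1, 2}"
    using assms by (simp, linarith)
  then show ?thesis
    by (intro CollectI exI[of _ "int m - \<lfloor>x\<rfloor>"]) simp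
qed

theorem mainTheorem6:
  fixes p :: nat and L l :: real
  assumes "p \<ge> 1"
    and "L = (1 + sqrt (4 * real p ^ 2 + 1)) / (2 * real p)"
    and "l = 1 / L"
  shows "\<forall>n::nat. n \<ge> 1 \<longrightarrow>
    int (greedy_perm p n) \<in>
      {\<lfloor>real n * L\<rfloor> + \<epsilon> | \<epsilon>. \<epsilon> \<in> {-1, 0, 1, 2}} \<union>
      {\<lfloor>real n * l\<rfloor> + \<epsilon> | \<epsilon>. \<epsilon> \<in> {-1, 0, 1, 2}}"
proof (intro allI impI)
  fix n :: nat assume "n \<ge> 1"
  have p1: "real p \<ge> 1"
    using assms(1) by simp
  define s where "s = sqrt (4 * real p ^ 2 + 1)"
  have s: "s * s = 4 * real p ^ 2 + 1"
    unfolding s_def by simp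
  have "2 * real p \<le> s"
    unfolding s_def by (rule real_le_rsqrt) (simp add: power2_eq_square)
  have Ls: "2 * real p * L = 1 + s"
    using assms(2) p1 by (simp add: s_def)
  have "L > 1"
    using Ls \<open>2 * real p \<le> s\<close> p1 by (smt (verit) mult_le_cancel_left1 mult_less_cancel_left1)
  then have l: "0 < l" "l < 1" and inv: "L * l = 1"
    using assms(3) by simp_all
  have "(2 * real p * L - 1) * (2 * real p * L - 1) = 4 * real p ^ 2 + 1"
    using Ls s by simp
  then have "4 * real p * (real p * L * L) = 4 * real p * (L + real p)"
    by (simp add: algebra_simps power2_eq_square)
  then have "real p * L * L = L + real p"
    using p1 by simp
  then have L: "L = l + 1 / real p"
    using p1 \<open>L > 1\<close> by (simp add: assms(3) field_simps)
  note near = wyt_b_near_multiple[OF assms(1) l L inv]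
  obtain i where "n = wyt_a p i + 1 \<or> n = wyt_b p i + 1"
    using wyt_cover[OF \<open>n \<ge> 1\<close>] by blast
  then show "int (greedy_perm p n) \<in>
      {\<lfloor>real n * L\<rfloor> + \<epsilon> | \<epsilon>. \<epsilon> \<in> {-1, 0, 1, 2}} \<union>
      {\<lfloor>real n * l\<rfloor> + \<epsilon> | \<epsilon>. \<epsilon> \<in> {-1, 0, 1, 2}}"
  proof
    assume n: "n = wyt_a p i + 1"
    show ?thesis
      unfolding n greedy_perm_a using mem_floor_window[OF near] by (rule UnI1)
  next
    assume n: "n = wyt_b p i + 1"
    \<comment> \<open>Multiplying the previous estimate by \<open>l < 1\<close> only shrinks the error.\<close>
    have cancel: "real (wyt_a p i + 1) * L * l = real (wyt_a p i + 1)"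
      using inv by (simp add: mult.assoc)
    have "(real (wyt_b p i + 1) - 2) * l < real (wyt_a p i + 1)"
      using mult_strict_right_mono[OF near(1)[of i] l(1)] unfolding cancel .
    then have "real (wyt_b p i + 1) * l < real (wyt_a p i + 1) + 2"
      using l by (simp add: algebra_simps)
    moreover have "real (wyt_a p i + 1) < (real (wyt_b p i + 1) + 2) * l"
      using mult_strict_right_mono[OF near(2)[of i] l(1)] unfolding cancel .
    then have "real (wyt_a p i + 1) - 2 < real (wyt_b p i + 1) * l"
      using l by (simp add: algebra_simps)
    ultimately show ?thesis
      unfolding n greedy_perm_b by (intro UnI2 mem_floor_window)
  qed
qed

end
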